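(* Let $X$ be an order complete locally solid $f$-ring with unity and the Fatou property. If $\mathsf{Hom}^{b}_{br}(X)$ has the Lebesgue property, then $X$ has the Lebesgue property.
   Context: An $\ell$-ring (lattice ring) is a ring which is also a lattice, the additive group being a lattice-ordered group, with $|x\cdot y|\le |x|\cdot|y|$ for all $x,y$. $X_+=\{x\in X: x\ge 0\}$. A set $S\subseteq X$ is solid if $x\in X$, $y\in S$, $|x|\le|y|$ imply $x\in S$. A locally solid $\ell$-ring is an $\ell$-ring that is also a topological ring and has a local basis at zero consisting of solid sets. An $f$-ring is an $\ell$-ring in which $a\wedge b=0$ and $c>0$ imply $ca\wedge b=ac\wedge b=0$; a locally solid $f$-ring is a locally solid $\ell$-ring that is an $f$-ring. Order complete: every non-empty subset that is bounded above has a supremum. A net $(x_\alpha)$ is order convergent to $x$ if there is a net $(z_\beta)$ (possibly over a different index set) with $z_\beta\downarrow 0$ such that for every $\beta$ there is $\alpha_0$ with $|x_\alpha-x|\le z_\beta$ for all $\alpha\ge\alpha_0$. A set is order closed if it contains the limits of all order convergent nets lying in it. $X$ has the Fatou property if its topology has a local basis at zero consisting of solid order closed neighborhoods. A locally solid $\ell$-ring has the Lebesgue property if every net with $u_\alpha\downarrow 0$ converges to $0$ topologically. A set $B$ in a topological ring is bounded if for each zero neighborhood $W$ there is a zero neighborhood $V$ with $VB\subseteq W$ and $BV\subseteq W$ (sets of products). A group homomorphism $T:X\to X$ (of the additive group) is order bounded if it maps order bounded sets (sets contained in an order interval $[u,v]$) to order bounded sets, and $br$-bounded if $T(B)$ is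 bounded for every bounded $B\subseteq X$. $\mathsf{Hom}^{b}_{br}(X)$ is the set of all order bounded $br$-bounded group homomorphisms $X\to X$, with pointwise addition, composition as multiplication, the order $T\le S$ iff $T(x)\le S(x)$ for all $x\in X_+$ (lattice operations given by Riesz–Kantorovich formulae, in particular $|T|(x)=\sup\{|T(u)|:|u|\le x\}$ for $x\in X_+$), and the topology of uniform convergence on bounded sets: $S_\alpha\to S$ iff for each bounded $B\subseteq X$ and each zero neighborhood $V\subseteq X$ there is $\alpha_0$ with $(S_\alpha-S)(B)\subseteq V$ for all $\alpha\ge\alpha_0$. It is a locally solid $\ell$-ring. Standing assumption: in every topological group considered (including the additive groups of topological rings), singletons are bounded in the group sense: for each $x$ and each neighborhood $U$ of the identity there is a positive integer $n$ with $x\in nU=\{x_1+\dots+x_n: x_i\in U\}$. *)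

theory Defs
  imports "HOL-Analysis.Analysis" "HOL-Library.Lattice_Algebras"
begin

section \<open>Locally solid lattice rings and f-rings\<close>

text \<open>
  An \<open>\<ell>\<close>-ring is the library class \<^class>\<open>lattice_ring\<close>. That class asks for monotone
  multiplication by nonnegative elements instead of \<open>\<bar>x * y\<bar> \<le> \<bar>x\<bar> * \<bar>y\<bar>\<close>; over a
  lattice-ordered group the two are equivalent, by \<open>abs_le_mult\<close> in one direction and by
  the next lemma in the other.
\<close>

lemma mult_mono_if_abs_mult_le:
  fixes a b c :: "'a :: {ring, lattice_ab_group_add_abs}"
  assumes "\<And>x y :: 'a. \<bar>x * y\<bar> \<le> \<bar>x\<bar> * \<bar>y\<bar>" and "a \<le> b" and "0 \<le> c"
  shows "c * a \<le> c * b" and "a * c \<le> b * c"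
proof -
  have nonneg: "0 \<le> x * y" if "0 \<le> x" "0 \<le> y" for x y :: 'a
    using assms(1)[of x y] that abs_ge_zero[of "x * y"] by simp
  show "c * a \<le> c * b"
    using nonneg[of c "b - a"] assms by (simp add: algebra_simps)
  show "a * c \<le> b * c"
    using nonneg[of "b - a" c] assms by (simp add: algebra_simps)
qed

definition (in lattice_ab_group_add_abs) solid :: "'a set \<Rightarrow> bool" where
  "solid S \<longleftrightarrow> (\<forall>x. \<forall>y\<in>S. \<bar>x\<bar> \<le> \<bar>y\<bar> \<longrightarrow> x \<in> S)"

text \<open>Neighbourhoods of zero are not required to be open.\<close>

definition (in topological_group_add) zero_nbhd :: "'a set \<Rightarrow> bool" where
  "zero_nbhd V \<longleftrightarrow> (\<forall>\<^sub>F x in nhds 0. x \<in> V)"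

class locally_solid_lattice_ring =
  lattice_ring + topological_ab_group_add + topological_semigroup_mult +
  assumes solid_basis: "zero_nbhd U \<Longrightarrow> \<exists>V. zero_nbhd V \<and> solid V \<and> V \<subseteq> U"

class f_ring = lattice_ring +
  assumes f_ring_left: "inf a b = 0 \<Longrightarrow> 0 < c \<Longrightarrow> inf (c * a) b = 0"
    and f_ring_right: "inf a b = 0 \<Longrightarrow> 0 < c \<Longrightarrow> inf (a * c) b = 0"

class locally_solid_f_ring = locally_solid_lattice_ring + f_ring

text \<open>Here \<open>\<Sum>i<n. f i\<close> with all \<open>f i\<close> in \<open>U\<close> is a general element of \<open>n U = U + \<dots> + U\<close>.\<close>

definition singletons_group_bounded :: "'a :: topological_ab_group_add itself \<Rightarrow> bool" where
  "singletons_group_bounded _ \<longleftrightarrow>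
    (\<forall>(x :: 'a) U. zero_nbhd U \<longrightarrow>
      (\<exists>n>0. \<exists>f :: nat \<Rightarrow> 'a. (\<forall>i<n. f i \<in> U) \<and> x = (\<Sum>i<n. f i)))"

lemma zero_nbhd_0: "zero_nbhd V \<Longrightarrow> 0 \<in> V"
  unfolding zero_nbhd_def by (rule eventually_nhds_x_imp_x)

lemma zero_nbhd_mono: "zero_nbhd V \<Longrightarrow> V \<subseteq> W \<Longrightarrow> zero_nbhd W"
  unfolding zero_nbhd_def by (auto elim: eventually_mono)

lemma zero_nbhd_UNIV: "zero_nbhd UNIV"
  unfolding zero_nbhd_def by simp

lemma zero_nbhd_Int: "zero_nbhd V \<Longrightarrow> zero_nbhd W \<Longrightarrow> zero_nbhd (V \<inter> W)"
  unfolding zero_nbhd_def by (simp add: eventually_conj)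

lemma zero_nbhd_add:
  fixes W :: "'a :: topological_group_add set"
  assumes "zero_nbhd W"
  shows "\<exists>V. zero_nbhd V \<and> (\<forall>x\<in>V. \<forall>y\<in>V. x + y \<in> W)"
proof -
  have "filterlim (\<lambda>p. fst p + snd p) (nhds (0 + 0)) (nhds (0 :: 'a) \<times>\<^sub>F nhds 0)"
    by (rule tendsto_add_Pair)
  then have "\<forall>\<^sub>F p in nhds (0 :: 'a) \<times>\<^sub>F nhds 0. fst p + snd p \<in> W"
    using assms unfolding zero_nbhd_def filterlim_iff by (auto dest!: spec[of _ "\<lambda>x. x \<in> W"])
  then obtain P where "eventually P (nhds (0 :: 'a))" "\<And>x y. P x \<Longrightarrow> P y \<Longrightarrow> x + y \<in> W"
    unfolding eventually_prod_same by auto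
  then show ?thesis
    by (intro exI[of _ "Collect P"]) (auto simp: zero_nbhd_def)
qed

lemma zero_nbhd_minus:
  fixes W :: "'a :: topological_group_add set"
  assumes "zero_nbhd W"
  shows "zero_nbhd {x. - x \<in> W}"
  using assms tendsto_uminus_nhds[of "0 :: 'a"]
  unfolding zero_nbhd_def filterlim_iff by (auto dest!: spec[of _ "\<lambda>x. x \<in> W"])

section \<open>Nets\<close>

text \<open>A net is a function on an index set \<open>A\<close> that is directed by the preorder \<open>le\<close>.\<close>

definition directed_set :: "'i set \<Rightarrow> ('i \<Rightarrow> 'i \<Rightarrow> bool) \<Rightarrow> bool" where
  "directed_set A le \<longleftrightarrow> A \<noteq> {} \<and> reflp_on A le \<and> transp_on A le \<and>
    (\<forall>a\<in>A. \<forall>b\<in>A. \<exists>c\<in>A. le a c \<and> le b c)"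

definition tails :: "'i set \<Rightarrow> ('i \<Rightarrow> 'i \<Rightarrow> bool) \<Rightarrow> 'i filter" where
  "tails A le = (INF a\<in>A. principal {b \<in> A. le a b})"

lemma eventually_tails:
  assumes "directed_set A le"
  shows "eventually P (tails A le) \<longleftrightarrow> (\<exists>a\<in>A. \<forall>b\<in>A. le a b \<longrightarrow> P b)"
proof -
  have "eventually P (tails A le) \<longleftrightarrow> (\<exists>a\<in>A. eventually P (principal {b \<in> A. le a b}))"
    unfolding tails_def
  proof (rule eventually_INF_base)
    show "A \<noteq> {}" using assms by (simp add: directed_set_def)
    fix a b assume ab: "a \<in> A" "b \<in> A"
    then obtain c where c: "c \<in> A" "le a c" "le b c"
      using assms unfolding directed_set_def by blast
    then have "{x \<in> A. le c x} \<subseteq> {x \<in> A. le a x} \<inter> {x \<in> A. le b x}"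
      using assms ab unfolding directed_set_def by (auto dest: transp_onD)
    then show "\<exists>x\<in>A. principal {b \<in> A. le x b} \<le>
        inf (principal {b \<in> A. le a b}) (principal {ba \<in> A. le b ba})"
      using c by auto
  qed
  then show ?thesis by (auto simp: eventually_principal)
qed

definition decreases_to ::
  "'i set \<Rightarrow> ('i \<Rightarrow> 'i \<Rightarrow> bool) \<Rightarrow> ('i \<Rightarrow> 'a :: order) \<Rightarrow> 'a \<Rightarrow> bool" where
  "decreases_to A le u x \<longleftrightarrow> directed_set A le \<and>
    (\<forall>a\<in>A. \<forall>b\<in>A. le a b \<longrightarrow> u b \<le> u a) \<and>
    (\<forall>a\<in>A. x \<le> u a) \<and> (\<forall>l. (\<forall>a\<in>A. l \<le> u a) \<longrightarrow> l \<le> x)"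

lemma decreases_to_image:
  assumes "decreases_to A le u x"
  shows "decreases_to (u ` A) (\<ge>) (\<lambda>y. y) x"
proof -
  have "directed_set (u ` A) (\<ge>)"
    unfolding directed_set_def
  proof (intro conjI)
    show "\<forall>a\<in>u ` A. \<forall>b\<in>u ` A. \<exists>c\<in>u ` A. a \<ge> c \<and> b \<ge> c"
    proof (clarsimp)
      fix a b assume ab: "a \<in> A" "b \<in> A"
      then obtain c where "c \<in> A" "le a c" "le b c"
        using assms unfolding decreases_to_def directed_set_def by blast
      then show "\<exists>c\<in>A. u c \<le> u a \<and> u c \<le> u b"
        using assms ab unfolding decreases_to_def by blast
    qed
  qed (use assms in \<open>auto simp: decreases_to_def directed_set_def intro!: reflp_onI transp_onI\<close>)
  then show ?thesis
    using assms unfolding decreases_to_def by auto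
qed

text \<open>
  HOL cannot quantify over the index types of nets inside a definition. In the three definitions
  below the bound nets are indexed by subsets (with arbitrary preorders) of the space itself;
  the lemmas after each definition show that this is the same as admitting all index types.
\<close>

definition lebesgue_property :: "'a :: {zero, order, topological_space} itself \<Rightarrow> bool" where
  "lebesgue_property _ \<longleftrightarrow>
    (\<forall>(A :: 'a set) le (u :: 'a \<Rightarrow> 'a). decreases_to A le u 0 \<longrightarrow> (u \<longlongrightarrow> 0) (tails A le))"

lemma lebesgue_property_any_index:
  fixes u :: "'i \<Rightarrow> 'a :: {zero, order, topological_space}"
  assumes L: "lebesgue_property TYPE('a)" and u: "decreases_to A le u 0"
  shows "(u \<longlongrightarrow> 0) (tails A le)"
proof (rule topological_tendstoI)
  fix S :: "'a set" assume S: "open S" "0 \<in> S"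
  have dirA: "directed_set A le" and dec: "\<And>a b. a \<in> A \<Longrightarrow> b \<in> A \<Longrightarrow> le a b \<Longrightarrow> u b \<le> u a"
    using u by (auto simp: decreases_to_def)
  have d: "decreases_to (u ` A) (\<ge>) (\<lambda>y. y) 0"
    using u by (rule decreases_to_image)
  then have dir: "directed_set (u ` A) (\<ge>)" by (simp add: decreases_to_def)
  have "((\<lambda>y. y) \<longlongrightarrow> 0) (tails (u ` A) (\<ge>))"
    using L[unfolded lebesgue_property_def] d by simp
  then have "\<forall>\<^sub>F y in tails (u ` A) (\<ge>). y \<in> S"
    using S by (rule topological_tendstoD)
  then have "\<exists>d\<in>u ` A. \<forall>d'\<in>u ` A. d' \<le> d \<longrightarrow> d' \<in> S"
    using eventually_tails[OF dir] by simp
  then obtain a where a: "a \<in> A" "\<And>b. b \<in> A \<Longrightarrow> u b \<le> u a \<Longrightarrow> u b \<in> S"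
    by blast
  then show "\<forall>\<^sub>F x in tails A le. u x \<in> S"
    unfolding eventually_tails[OF dirA] using dec by blast
qed

definition order_converges ::
  "'i set \<Rightarrow> ('i \<Rightarrow> 'i \<Rightarrow> bool) \<Rightarrow> ('i \<Rightarrow> 'a :: lattice_ab_group_add_abs) \<Rightarrow> 'a \<Rightarrow> bool" where
  "order_converges A le x l \<longleftrightarrow>
    (\<exists>(B :: 'a set) le' (z :: 'a \<Rightarrow> 'a). decreases_to B le' z 0 \<and>
      (\<forall>\<beta>\<in>B. \<exists>\<alpha>\<^sub>0\<in>A. \<forall>\<alpha>\<in>A. le \<alpha>\<^sub>0 \<alpha> \<longrightarrow> \<bar>x \<alpha> - l\<bar> \<le> z \<beta>))"

lemma order_converges_any_index:
  fixes x :: "'i \<Rightarrow> 'a :: lattice_ab_group_add_abs" and z :: "'j \<Rightarrow> 'a"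
  assumes "decreases_to B le' z 0"
    and "\<And>\<beta>. \<beta> \<in> B \<Longrightarrow> \<exists>\<alpha>\<^sub>0\<in>A. \<forall>\<alpha>\<in>A. le \<alpha>\<^sub>0 \<alpha> \<longrightarrow> \<bar>x \<alpha> - l\<bar> \<le> z \<beta>"
  shows "order_converges A le x l"
  unfolding order_converges_def
  by (intro exI[of _ "z ` B"] exI[of _ "(\<ge>)"] exI[of _ "\<lambda>y. y"] conjI
    decreases_to_image[OF assms(1)]) (use assms(2) in blast)

definition order_closed :: "'a :: lattice_ab_group_add_abs set \<Rightarrow> bool" where
  "order_closed S \<longleftrightarrow>
    (\<forall>(A :: 'a set) le (x :: 'a \<Rightarrow> 'a) l. directed_set A le \<longrightarrow> (\<forall>\<alpha>\<in>A. x \<alpha> \<in> S) \<longrightarrow>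
      order_converges A le x l \<longrightarrow> l \<in> S)"

lemma order_closed_any_index:
  fixes x :: "'i \<Rightarrow> 'a :: lattice_ab_group_add_abs"
  assumes S: "order_closed S" and dir: "directed_set A le"
    and x: "\<And>\<alpha>. \<alpha> \<in> A \<Longrightarrow> x \<alpha> \<in> S" and conv: "order_converges A le x l"
  shows "l \<in> S"
proof -
  obtain B le' and z :: "'a \<Rightarrow> 'a" where z: "decreases_to B le' z 0"
    and dom: "\<And>\<beta>. \<beta> \<in> B \<Longrightarrow> \<exists>\<alpha>\<^sub>0\<in>A. \<forall>\<alpha>\<in>A. le \<alpha>\<^sub>0 \<alpha> \<longrightarrow> \<bar>x \<alpha> - l\<bar> \<le> z \<beta>"
    using conv unfolding order_converges_def by blast
  define D where "D = z ` B"
  have D: "decreases_to D (\<ge>) (\<lambda>y. y) 0"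
    unfolding D_def using z by (rule decreases_to_image)
  then have dirD: "directed_set D (\<ge>)" by (simp add: decreases_to_def)
  have "\<forall>d\<in>D. \<exists>\<alpha>\<in>A. \<bar>x \<alpha> - l\<bar> \<le> d"
  proof
    fix d assume "d \<in> D"
    then obtain \<alpha>\<^sub>0 where a0: "\<alpha>\<^sub>0 \<in> A" "\<forall>\<alpha>\<in>A. le \<alpha>\<^sub>0 \<alpha> \<longrightarrow> \<bar>x \<alpha> - l\<bar> \<le> d"
      using dom unfolding D_def by blast
    moreover have "le \<alpha>\<^sub>0 \<alpha>\<^sub>0"
      using dir a0(1) unfolding directed_set_def by (blast dest: reflp_onD)
    ultimately show "\<exists>\<alpha>\<in>A. \<bar>x \<alpha> - l\<bar> \<le> d" by blast
  qed
  then obtain c where c: "\<And>d. d \<in> D \<Longrightarrow> c d \<in> A \<and> \<bar>x (c d) - l\<bar> \<le> d" by metis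
  have "order_converges D (\<ge>) (\<lambda>d. x (c d)) l"
    using D by (rule order_converges_any_index) (use c order_trans in blast)
  moreover have "\<forall>d\<in>D. x (c d) \<in> S" using c x by blast
  moreover have "directed_set D (\<ge>) \<longrightarrow> (\<forall>d\<in>D. x (c d) \<in> S) \<longrightarrow>
      order_converges D (\<ge>) (\<lambda>d. x (c d)) l \<longrightarrow> l \<in> S"
    using S[unfolded order_closed_def, THEN spec[of _ D], THEN spec[of _ "(\<ge>)"],
        THEN spec[of _ "\<lambda>d. x (c d)"], THEN spec[of _ l]] .
  ultimately show ?thesis using dirD by blast
qed

definition fatou_property :: "'a :: locally_solid_lattice_ring itself \<Rightarrow> bool" where
  "fatou_property _ \<longleftrightarrow>
    (\<forall>U :: 'a set. zero_nbhd U \<longrightarrow>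
      (\<exists>V. zero_nbhd V \<and> solid V \<and> order_closed V \<and> V \<subseteq> U))"

section \<open>Bounded sets and bounded homomorphisms\<close>

definition ring_bounded ::
  "'a :: {topological_ab_group_add, topological_semigroup_mult, ring} set \<Rightarrow> bool" where
  "ring_bounded B \<longleftrightarrow>
    (\<forall>W. zero_nbhd W \<longrightarrow> (\<exists>V. zero_nbhd V \<and> (\<forall>v\<in>V. \<forall>b\<in>B. v * b \<in> W \<and> b * v \<in> W)))"

definition br_bounded ::
  "('a :: {topological_ab_group_add, topological_semigroup_mult, ring} \<Rightarrow> 'a) \<Rightarrow> bool" where
  "br_bounded T \<longleftrightarrow> (\<forall>B. ring_bounded B \<longrightarrow> ring_bounded (T ` B))"

definition order_bounded_set :: "'a :: order set \<Rightarrow> bool" where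
  "order_bounded_set A \<longleftrightarrow> (\<exists>u v. A \<subseteq> {u..v})"

definition order_bounded_map :: "('a :: order \<Rightarrow> 'a) \<Rightarrow> bool" where
  "order_bounded_map T \<longleftrightarrow> (\<forall>A. order_bounded_set A \<longrightarrow> order_bounded_set (T ` A))"

lemma ring_bounded_subset: "ring_bounded B \<Longrightarrow> A \<subseteq> B \<Longrightarrow> ring_bounded A"
  unfolding ring_bounded_def by blast

lemma ring_bounded_empty: "ring_bounded {}"
  unfolding ring_bounded_def using zero_nbhd_UNIV by blast

lemma ring_bounded_Un:
  assumes "ring_bounded A" "ring_bounded B"
  shows "ring_bounded (A \<union> B)"
  unfolding ring_bounded_def
proof (intro allI impI)
  fix W :: "'a set" assume W: "zero_nbhd W"
  obtain V1 where V1: "zero_nbhd V1" "\<forall>v\<in>V1. \<forall>b\<in>A. v * b \<in> W \<and> b * v \<in> W"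
    using assms(1) W unfolding ring_bounded_def by blast
  obtain V2 where V2: "zero_nbhd V2" "\<forall>v\<in>V2. \<forall>b\<in>B. v * b \<in> W \<and> b * v \<in> W"
    using assms(2) W unfolding ring_bounded_def by blast
  with V1 show "\<exists>V. zero_nbhd V \<and> (\<forall>v\<in>V. \<forall>b\<in>A \<union> B. v * b \<in> W \<and> b * v \<in> W)"
    by (intro exI[of _ "V1 \<inter> V2"]) (auto intro: zero_nbhd_Int)
qed

lemma ring_bounded_zero: "ring_bounded {0}"
  unfolding ring_bounded_def by (auto intro: zero_nbhd_UNIV zero_nbhd_0)

lemma ring_bounded_minus:
  assumes "ring_bounded B"
  shows "ring_bounded (uminus ` B)"
  unfolding ring_bounded_def
proof (intro allI impI)
  fix W :: "'a set" assume "zero_nbhd W"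
  then have "zero_nbhd {x. - x \<in> W}" by (rule zero_nbhd_minus)
  then obtain V where "zero_nbhd V" "\<forall>v\<in>V. \<forall>b\<in>B. - (v * b) \<in> W \<and> - (b * v) \<in> W"
    using assms unfolding ring_bounded_def by fast
  then show "\<exists>V. zero_nbhd V \<and> (\<forall>v\<in>V. \<forall>b\<in>uminus ` B. v * b \<in> W \<and> b * v \<in> W)"
    by auto
qed

lemma ring_bounded_add:
  assumes "ring_bounded A" "ring_bounded B"
  shows "ring_bounded {a + b | a b. a \<in> A \<and> b \<in> B}"
  unfolding ring_bounded_def
proof (intro allI impI)
  fix W :: "'a set" assume "zero_nbhd W"
  then obtain U where U: "zero_nbhd U" "\<forall>x\<in>U. \<forall>y\<in>U. x + y \<in> W"
    using zero_nbhd_add by blast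
  obtain V1 where V1: "zero_nbhd V1" "\<forall>v\<in>V1. \<forall>b\<in>A. v * b \<in> U \<and> b * v \<in> U"
    using assms(1) U(1) unfolding ring_bounded_def by blast
  obtain V2 where V2: "zero_nbhd V2" "\<forall>v\<in>V2. \<forall>b\<in>B. v * b \<in> U \<and> b * v \<in> U"
    using assms(2) U(1) unfolding ring_bounded_def by blast
  with V1 show "\<exists>V. zero_nbhd V \<and>
      (\<forall>v\<in>V. \<forall>b\<in>{a + b | a b. a \<in> A \<and> b \<in> B}. v * b \<in> W \<and> b * v \<in> W)"
    using U(2)
    by (intro exI[of _ "V1 \<inter> V2"]) (auto intro: zero_nbhd_Int simp: distrib_left distrib_right)
qed

lemma zero_map_bounded:
  "Modules.additive (\<lambda>_ :: 'a. 0 :: 'a) \<and> order_bounded_map (\<lambda>_ :: 'a. 0 :: 'a) \<and>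
    br_bounded (\<lambda>_ :: 'a. 0 :: 'a :: locally_solid_lattice_ring)"
proof (intro conjI)
  show "order_bounded_map (\<lambda>_ :: 'a. 0 :: 'a)"
    unfolding order_bounded_map_def order_bounded_set_def
    by (intro allI impI exI[of _ 0]) auto
  have "ring_bounded ((\<lambda>_. 0 :: 'a) ` B)" for B :: "'a set"
    by (rule ring_bounded_subset[OF ring_bounded_zero]) auto
  then show "br_bounded (\<lambda>_ :: 'a. 0 :: 'a)" by (simp add: br_bounded_def)
qed (simp add: Modules.additive_def)

section \<open>The ring of order bounded br-bounded homomorphisms\<close>

typedef (overloaded) 'a hom_b_br =
  "{T :: 'a :: locally_solid_lattice_ring \<Rightarrow> 'a.
      Modules.additive T \<and> order_bounded_map T \<and> br_bounded T}"
  morphisms hom_apply Abs_hom_b_br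
  using zero_map_bounded by blast

setup_lifting type_definition_hom_b_br

instantiation hom_b_br :: (locally_solid_lattice_ring) ring
begin

lift_definition zero_hom_b_br :: "'a hom_b_br" is "\<lambda>_. 0"
  by (rule zero_map_bounded)

lift_definition plus_hom_b_br :: "'a hom_b_br \<Rightarrow> 'a hom_b_br \<Rightarrow> 'a hom_b_br"
  is "\<lambda>T S x. T x + S x"
proof (intro conjI)
  fix T S :: "'a \<Rightarrow> 'a"
  assume T: "Modules.additive T \<and> order_bounded_map T \<and> br_bounded T"
    and S: "Modules.additive S \<and> order_bounded_map S \<and> br_bounded S"
  show "Modules.additive (\<lambda>x. T x + S x)"
    using T S by (simp add: Modules.additive_def algebra_simps)
  show "order_bounded_map (\<lambda>x. T x + S x)"
    unfolding order_bounded_map_def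
  proof (intro allI impI)
    fix A :: "'a set" assume "order_bounded_set A"
    then obtain u v u' v' where "T ` A \<subseteq> {u..v}" "S ` A \<subseteq> {u'..v'}"
      using T S unfolding order_bounded_map_def order_bounded_set_def by meson
    then have "(\<lambda>x. T x + S x) ` A \<subseteq> {u + u'..v + v'}"
      by (force intro: add_mono)
    then show "order_bounded_set ((\<lambda>x. T x + S x) ` A)"
      unfolding order_bounded_set_def by blast
  qed
  show "br_bounded (\<lambda>x. T x + S x)"
    unfolding br_bounded_def
  proof (intro allI impI)
    fix B :: "'a set" assume "ring_bounded B"
    then have "ring_bounded {a + b | a b. a \<in> T ` B \<and> b \<in> S ` B}"
      using T S by (intro ring_bounded_add) (auto simp: br_bounded_def)
    then show "ring_bounded ((\<lambda>x. T x + S x) ` B)" by (rule ring_bounded_subset) auto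
  qed
qed

lift_definition uminus_hom_b_br :: "'a hom_b_br \<Rightarrow> 'a hom_b_br" is "\<lambda>T x. - T x"
proof (intro conjI)
  fix T :: "'a \<Rightarrow> 'a"
  assume T: "Modules.additive T \<and> order_bounded_map T \<and> br_bounded T"
  show "Modules.additive (\<lambda>x. - T x)"
    using T by (simp add: Modules.additive_def)
  show "order_bounded_map (\<lambda>x. - T x)"
    unfolding order_bounded_map_def
  proof (intro allI impI)
    fix A :: "'a set" assume "order_bounded_set A"
    then obtain u v where "T ` A \<subseteq> {u..v}"
      using T unfolding order_bounded_map_def order_bounded_set_def by meson
    then have "(\<lambda>x. - T x) ` A \<subseteq> {- v..- u}" by auto
    then show "order_bounded_set ((\<lambda>x. - T x) ` A)"
      unfolding order_bounded_set_def by blast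
  qed
  show "br_bounded (\<lambda>x. - T x)"
    using T ring_bounded_minus[of "T ` _"] by (simp add: br_bounded_def image_image)
qed

lift_definition minus_hom_b_br :: "'a hom_b_br \<Rightarrow> 'a hom_b_br \<Rightarrow> 'a hom_b_br"
  is "\<lambda>T S x. T x - S x"
proof -
  fix T S :: "'a \<Rightarrow> 'a"
  assume T: "Modules.additive T \<and> order_bounded_map T \<and> br_bounded T"
    and S: "Modules.additive S \<and> order_bounded_map S \<and> br_bounded S"
  have "hom_apply (Abs_hom_b_br T + - Abs_hom_b_br S) = (\<lambda>x. T x - S x)"
    using T S by (simp add: plus_hom_b_br.rep_eq uminus_hom_b_br.rep_eq Abs_hom_b_br_inverse)
  then show "Modules.additive (\<lambda>x. T x - S x) \<and> order_bounded_map (\<lambda>x. T x - S x) \<and>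
      br_bounded (\<lambda>x. T x - S x)"
    using hom_apply[of "Abs_hom_b_br T + - Abs_hom_b_br S"] by simp
qed

lift_definition times_hom_b_br :: "'a hom_b_br \<Rightarrow> 'a hom_b_br \<Rightarrow> 'a hom_b_br"
  is "\<lambda>T S. T \<circ> S"
  unfolding Modules.additive_def order_bounded_map_def br_bounded_def image_comp[symmetric]
  by simp

instance
  by standard (transfer; auto simp: Modules.additive_def fun_eq_iff algebra_simps)+

end

instantiation hom_b_br :: (locally_solid_lattice_ring) ordered_ab_group_add
begin

lift_definition less_eq_hom_b_br :: "'a hom_b_br \<Rightarrow> 'a hom_b_br \<Rightarrow> bool"
  is "\<lambda>T S. \<forall>x\<ge>0. T x \<le> S x" .

definition less_hom_b_br :: "'a hom_b_br \<Rightarrow> 'a hom_b_br \<Rightarrow> bool" where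
  "less_hom_b_br T S \<longleftrightarrow> T \<le> S \<and> \<not> S \<le> T"

instance
proof
  fix T S R :: "'a hom_b_br"
  show "T < S \<longleftrightarrow> T \<le> S \<and> \<not> S \<le> T" by (rule less_hom_b_br_def)
  show "T \<le> T" by transfer simp
  show "T \<le> R" if "T \<le> S" "S \<le> R" using that by transfer (blast intro: order_trans)
  show "R + T \<le> R + S" if "T \<le> S" using that by transfer simp
  show "T = S" if "T \<le> S" "S \<le> T" using that
  proof transfer
    fix T S :: "'a \<Rightarrow> 'a"
    assume T: "Modules.additive T \<and> order_bounded_map T \<and> br_bounded T"
      and S: "Modules.additive S \<and> order_bounded_map S \<and> br_bounded S"
      and "\<forall>x\<ge>0. T x \<le> S x" "\<forall>x\<ge>0. S x \<le> T x"
    then have eq: "T x = S x" if "0 \<le> x" for x using that by (simp add: order.antisym)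
    show "T = S"
    proof
      fix x :: 'a
      have x: "x = pprt x - (- nprt x)" using prts[of x] by simp
      have "T x = T (pprt x) - T (- nprt x)" using T x by (metis Modules.additive.diff)
      also have "\<dots> = S (pprt x) - S (- nprt x)" by (simp add: eq)
      also have "\<dots> = S x" using S x by (metis Modules.additive.diff)
      finally show "T x = S x" .
    qed
  qed
qed

end

text \<open>
  The topology of uniform convergence on bounded sets; see \<open>tendsto_hom_b_br_iff\<close> below for
  its characterisation by convergence.
\<close>

instantiation hom_b_br :: (locally_solid_lattice_ring) topological_space
begin

definition open_hom_b_br :: "'a hom_b_br set \<Rightarrow> bool" where
  "open_hom_b_br U \<longleftrightarrow>
    (\<forall>S\<in>U. \<exists>B V. ring_bounded B \<and> zero_nbhd V \<and>
      {R. hom_apply (R - S) ` B \<subseteq> V} \<subseteq> U)"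

instance
proof
  show "open (UNIV :: 'a hom_b_br set)"
    unfolding open_hom_b_br_def using ring_bounded_empty zero_nbhd_UNIV by blast
  show "open (\<Union> K)" if K: "\<forall>S\<in>K. open S" for K :: "'a hom_b_br set set"
    unfolding open_hom_b_br_def
  proof
    fix S assume "S \<in> \<Union> K"
    then obtain U where U: "U \<in> K" "S \<in> U" by blast
    have "open U" using K U(1) by blast
    then obtain B V where BV: "ring_bounded B" "zero_nbhd V"
      and sub: "{R. hom_apply (R - S) ` B \<subseteq> V} \<subseteq> U"
      using U(2) unfolding open_hom_b_br_def by blast
    have "{R. hom_apply (R - S) ` B \<subseteq> V} \<subseteq> \<Union> K"
      using sub U(1) by (rule order_trans[OF _ Union_upper])
    with BV show "\<exists>B V. ring_bounded B \<and> zero_nbhd V \<and>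
        {R. hom_apply (R - S) ` B \<subseteq> V} \<subseteq> \<Union> K"
      by (intro exI conjI)
  qed
  show "open (U1 \<inter> U2)" if U: "open U1" "open U2" for U1 U2 :: "'a hom_b_br set"
    unfolding open_hom_b_br_def
  proof
    fix S assume S: "S \<in> U1 \<inter> U2"
    obtain B1 V1 where 1: "ring_bounded B1" "zero_nbhd V1"
      "{R. hom_apply (R - S) ` B1 \<subseteq> V1} \<subseteq> U1"
      using U(1) S unfolding open_hom_b_br_def by blast
    obtain B2 V2 where 2: "ring_bounded B2" "zero_nbhd V2"
      "{R. hom_apply (R - S) ` B2 \<subseteq> V2} \<subseteq> U2"
      using U(2) S unfolding open_hom_b_br_def by blast
    show "\<exists>B V. ring_bounded B \<and> zero_nbhd V \<and> {R. hom_apply (R - S) ` B \<subseteq> V} \<subseteq> U1 \<inter> U2"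
    proof (intro exI conjI)
      show "ring_bounded (B1 \<union> B2)" using 1 2 by (intro ring_bounded_Un)
      show "zero_nbhd (V1 \<inter> V2)" using 1 2 by (intro zero_nbhd_Int)
      show "{R. hom_apply (R - S) ` (B1 \<union> B2) \<subseteq> V1 \<inter> V2} \<subseteq> U1 \<inter> U2"
        using 1(3) 2(3) by (simp add: image_Un subset_iff)
    qed
  qed
qed

end

lemma tendsto_hom_b_br_iff:
  "(F \<longlongrightarrow> S) net \<longleftrightarrow>
    (\<forall>B V. ring_bounded B \<longrightarrow> zero_nbhd V \<longrightarrow> (\<forall>\<^sub>F i in net. hom_apply (F i - S) ` B \<subseteq> V))"
  (is "?lhs \<longleftrightarrow> ?rhs")
proof
  assume ?rhs
  show ?lhs
  proof (rule topological_tendstoI)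
    fix U assume "open U" "S \<in> U"
    then obtain B V where BV: "ring_bounded B" "zero_nbhd V"
      and sub: "{R. hom_apply (R - S) ` B \<subseteq> V} \<subseteq> U"
      unfolding open_hom_b_br_def by blast
    have "\<forall>\<^sub>F i in net. hom_apply (F i - S) ` B \<subseteq> V"
      using \<open>?rhs\<close> BV by simp
    then show "\<forall>\<^sub>F i in net. F i \<in> U"
      by (rule eventually_mono) (use sub in blast)
  qed
next
  assume lhs: ?lhs
  show ?rhs
  proof (intro allI impI)
    fix B V :: "'b set" assume B: "ring_bounded B" and V: "zero_nbhd V"
    define N where "N = {R. \<exists>W. zero_nbhd W \<and> (\<forall>x\<in>B. \<forall>w\<in>W. hom_apply (R - S) x + w \<in> V)}"
    have "open N"
      unfolding open_hom_b_br_def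
    proof
      fix R assume "R \<in> N"
      then obtain W where W: "zero_nbhd W" "\<And>x w. x \<in> B \<Longrightarrow> w \<in> W \<Longrightarrow> hom_apply (R - S) x + w \<in> V"
        unfolding N_def by blast
      obtain W' where W': "zero_nbhd W'" "\<And>x y. x \<in> W' \<Longrightarrow> y \<in> W' \<Longrightarrow> x + y \<in> W"
        using zero_nbhd_add[OF W(1)] by blast
      have "R' \<in> N" if "hom_apply (R' - R) ` B \<subseteq> W'" for R'
      proof -
        have "hom_apply (R' - S) x + w \<in> V" if "x \<in> B" "w \<in> W'" for x w
        proof -
          have "hom_apply (R' - R) x + w \<in> W"
            using W'(2) that \<open>hom_apply (R' - R) ` B \<subseteq> W'\<close> by blast
          then have "hom_apply (R - S) x + (hom_apply (R' - R) x + w) \<in> V" using W that by blast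
          then show ?thesis by (simp add: minus_hom_b_br.rep_eq algebra_simps)
        qed
        then show ?thesis unfolding N_def using W'(1) by blast
      qed
      then have "{R'. hom_apply (R' - R) ` B \<subseteq> W'} \<subseteq> N" by blast
      with B W'(1) show "\<exists>B V. ring_bounded B \<and> zero_nbhd V \<and>
          {R'. hom_apply (R' - R) ` B \<subseteq> V} \<subseteq> N"
        by (intro exI conjI)
    qed
    moreover have "S \<in> N"
      unfolding N_def using V by (intro CollectI exI[of _ V]) (simp add: zero_hom_b_br.rep_eq)
    ultimately have "\<forall>\<^sub>F i in net. F i \<in> N" using lhs by (simp add: tendsto_def)
    then show "\<forall>\<^sub>F i in net. hom_apply (F i - S) ` B \<subseteq> V"
    proof (rule eventually_mono)
      fix i assume "F i \<in> N"
      then obtain W where W: "zero_nbhd W"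
        and *: "\<forall>x\<in>B. \<forall>w\<in>W. hom_apply (F i - S) x + w \<in> V"
        unfolding N_def by blast
      have "hom_apply (F i - S) x \<in> V" if "x \<in> B" for x
        using bspec[OF bspec[OF * that] zero_nbhd_0[OF W]] by simp
      then show "hom_apply (F i - S) ` B \<subseteq> V" by blast
    qed
  qed
qed

end

theory Submission
  imports Defs
begin

text \<open>
  Left multiplication embeds \<open>X\<close> into the ring of homomorphisms: \<open>L\<^sub>u x = u * x\<close> is order
  bounded and maps bounded sets to bounded sets, and the unity recovers \<open>u = L\<^sub>u 1\<close>.
  If the net \<open>u\<^sub>\<alpha>\<close> decreases to \<open>0\<close> and also \<open>L\<close> sends it to a net that decreases to \<open>0\<close>, then
  the Lebesgue property of the homomorphisms makes \<open>L\<^sub>u\<close> converge to \<open>0\<close> uniformly on bounded sets,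
  and evaluation at \<open>1\<close>, on the bounded set \<open>{1}\<close>, gives the topological convergence of \<open>u\<^sub>\<alpha>\<close>.

  Since the order on homomorphisms is pointwise on the positive cone, what has to be shown is that
  multiplication by a fixed \<open>x \<ge> 0\<close> is order continuous (\<open>decreases_to_mult_right\<close>). For
  \<open>x = n \<cdot> 1\<close> this holds in every partially ordered abelian group. The general case is reduced to it by
  \<open>n \<cdot> x \<le> n\<^sup>2 \<cdot> 1 + x\<^sup>2\<close>, a consequence of the positivity of squares in f-rings: a lower bound
  \<open>l\<close> of all \<open>u\<^sub>\<alpha> * x\<close> satisfies \<open>n \<cdot> l \<le> n\<^sup>2 \<cdot> u\<^sub>\<alpha> + u\<^sub>\<beta> * x\<^sup>2\<close> for a fixed \<open>\<beta>\<close> and all \<open>\<alpha>\<close>.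
  Letting \<open>u\<^sub>\<alpha>\<close> decrease to \<open>0\<close> leaves \<open>n \<cdot> l \<le> u\<^sub>\<beta> * x\<^sup>2\<close> for every \<open>n\<close>, so \<open>l \<le> 0\<close> because an
  order complete group is Archimedean.
\<close>

text \<open>
  Shifting the index by one shows that the supremum \<open>s\<close> of the multiples of \<open>l\<close> satisfies
  \<open>s + l \<le> s\<close>. The multiple \<open>n \<cdot> l\<close> is written as a constant sum because \<open>of_nat\<close> needs a
  ring with \<open>0 \<noteq> 1\<close>.
\<close>

lemma archimedean_if_conditionally_complete:
  fixes l b :: "'a :: {ordered_ab_group_add, conditionally_complete_lattice}"
  assumes bound: "\<And>n :: nat. (\<Sum>i<n. l) \<le> b"
  shows "l \<le> 0"
proof -
  define s where "s = (SUP n::nat. \<Sum>i<n. l)"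
  have bdd: "bdd_above (range (\<lambda>n::nat. \<Sum>i<n. l))"
    using bound by (intro bdd_aboveI[of _ b]) auto
  have "(\<Sum>i<n. l) \<le> s - l" for n :: nat
  proof -
    have "(\<Sum>i<Suc n. l) \<le> s"
      unfolding s_def by (intro cSUP_upper bdd UNIV_I)
    then show ?thesis by (simp add: le_diff_eq add.commute)
  qed
  then have "s \<le> s - l"
    using cSUP_least[of UNIV "\<lambda>n::nat. \<Sum>i<n. l" "s - l"] by (simp add: s_def)
  then show ?thesis by (simp add: le_diff_eq)
qed

text \<open>
  Directedness allows the two nets to be evaluated at independent indices, so that the two
  infima can be taken one after the other.
\<close>

lemma decreases_to_add:
  fixes x y :: "'a :: ordered_ab_group_add"
  assumes u: "decreases_to A le u x" and v: "decreases_to A le v y"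
  shows "decreases_to A le (\<lambda>a. u a + v a) (x + y)"
proof -
  have "l \<le> x + y" if l: "\<forall>a\<in>A. l \<le> u a + v a" for l
  proof -
    have "l - u a \<le> v b" if ab: "a \<in> A" "b \<in> A" for a b
    proof -
      obtain c where c: "c \<in> A" "le a c" "le b c"
        using u ab unfolding decreases_to_def directed_set_def by blast
      have "l \<le> u c + v c" using l c by blast
      also have "\<dots> \<le> u a + v b"
        using u v ab c unfolding decreases_to_def by (intro add_mono) blast+
      finally show ?thesis by (simp add: diff_le_eq add.commute)
    qed
    then have "l - u a \<le> y" if "a \<in> A" for a
      using v that unfolding decreases_to_def by blast
    then have "\<forall>a\<in>A. l - y \<le> u a" by (simp add: diff_le_eq add.commute)
    then have "l - y \<le> x" using u unfolding decreases_to_def by blast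
    then show ?thesis by (simp add: diff_le_eq)
  qed
  then show ?thesis
    using u v unfolding decreases_to_def by (auto intro: add_mono)
qed

lemma decreases_to_mult_sum_one:
  fixes u :: "'i \<Rightarrow> 'a :: {ordered_ring, monoid_mult}" and n :: nat
  assumes u: "decreases_to A le u 0"
  shows "decreases_to A le (\<lambda>a. u a * (\<Sum>i<n. 1)) 0"
proof (induction n)
  case 0
  then show ?case using u by (auto simp: decreases_to_def directed_set_def)
next
  case (Suc n)
  then show ?case using decreases_to_add[OF Suc u] by (simp add: distrib_left)
qed

section \<open>Order continuity of multiplication in f-rings\<close>

lemma f_ring_disjoint_mult:
  fixes a b :: "'a :: f_ring"
  assumes "inf a b = 0"
  shows "a * b = 0"
proof (cases "a = 0 \<or> b = 0")
  case False
  have "0 \<le> a" "0 \<le> b" using assms inf.cobounded1[of a b] inf.cobounded2[of a b] by auto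
  then have pos: "0 < a" "0 < b" using False by auto
  \<comment> \<open>Multiply the first entry by \<open>b\<close> and then the second one by \<open>a\<close>.\<close>
  have "inf b (a * b) = 0"
    using f_ring_right[OF assms pos(2)] by (simp add: inf.commute)
  then have "inf (a * b) (a * b) = 0" using pos(1) by (rule f_ring_left)
  then show ?thesis by simp
qed auto

text \<open>The mixed products of the positive and the negative part vanish.\<close>

lemma f_ring_square_nonneg:
  fixes a :: "'a :: f_ring"
  shows "0 \<le> a * a"
proof -
  define p q where "p = pprt a" and "q = - nprt a"
  have a: "a = p - q" using prts[of a] by (simp add: p_def q_def)
  have nonneg: "0 \<le> p" "0 \<le> q" by (simp_all add: p_def q_def)
  have "inf p q = q + inf (p - q) 0" by (simp add: add_inf_distrib_left)
  also have "\<dots> = q + nprt a" by (simp add: a[symmetric] nprt_def)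
  also have "\<dots> = 0" by (simp add: q_def)
  finally have disj: "inf p q = 0" .
  then have "p * q = 0" "q * p = 0"
    using f_ring_disjoint_mult[of p q] f_ring_disjoint_mult[of q p] by (simp_all add: inf.commute)
  then have "a * a = p * p + q * q" by (simp add: a algebra_simps)
  then show ?thesis using nonneg by simp
qed

lemma decreases_to_mult_right:
  fixes u :: "'i \<Rightarrow> 'a :: {f_ring, monoid_mult, conditionally_complete_lattice}"
  assumes u: "decreases_to A le u 0" and x: "0 \<le> x"
  shows "decreases_to A le (\<lambda>a. u a * x) 0"
proof -
  have dir: "directed_set A le"
    and dec: "\<And>a b. a \<in> A \<Longrightarrow> b \<in> A \<Longrightarrow> le a b \<Longrightarrow> u b \<le> u a"
    and nonneg: "\<And>a. a \<in> A \<Longrightarrow> 0 \<le> u a"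
    using u unfolding decreases_to_def by auto
  have "l \<le> 0" if l: "\<forall>a\<in>A. l \<le> u a * x" for l
  proof -
    obtain b where b: "b \<in> A" using dir unfolding directed_set_def by blast
    have "(\<Sum>i<n. l) \<le> u b * (x * x)" for n :: nat
    proof -
      define e :: 'a where "e = (\<Sum>i<n. 1)"
      have "0 \<le> (1 :: 'a)" using f_ring_square_nonneg[of "1 :: 'a"] by simp
      then have e: "0 \<le> e" unfolding e_def by (intro sum_nonneg)
      have comm: "e * x = x * e" unfolding e_def by (simp add: sum_distrib_left sum_distrib_right)
      \<comment> \<open>Expanding \<open>0 \<le> (e - x)\<^sup>2\<close> even bounds \<open>2 \<cdot> (x * e)\<close>; as \<open>x * e \<ge> 0\<close>, one copy can be dropped.\<close>
      have "0 \<le> (e - x) * (e - x)" by (rule f_ring_square_nonneg)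
      then have "x * e + x * e \<le> e * e + x * x" by (simp add: algebra_simps comm)
      moreover have "x * e \<le> x * e + x * e" using x e by simp
      ultimately have amgm: "x * e \<le> e * e + x * x" by (rule order_trans[rotated])
      have "l * e - u b * (x * x) \<le> u a * e * e" if a: "a \<in> A" for a
      proof -
        obtain c where c: "c \<in> A" "le a c" "le b c"
          using dir a b unfolding directed_set_def by blast
        have "l * e \<le> (u c * x) * e" using l c(1) e by (intro mult_right_mono) auto
        also have "\<dots> = u c * (x * e)" by (simp add: mult.assoc)
        also have "\<dots> \<le> u c * (e * e + x * x)" using amgm nonneg[OF c(1)] by (rule mult_left_mono)
        also have "\<dots> = u c * (e * e) + u c * (x * x)" by (rule distrib_left)
        also have "\<dots> \<le> u a * (e * e) + u b * (x * x)"
          using dec a b c x e by (intro add_mono mult_right_mono mult_nonneg_nonneg) auto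
        finally show ?thesis by (simp add: diff_le_eq mult.assoc)
      qed
      moreover have "decreases_to A le (\<lambda>a. u a * e * e) 0"
        unfolding e_def by (intro decreases_to_mult_sum_one u)
      ultimately have "l * e - u b * (x * x) \<le> 0" unfolding decreases_to_def by blast
      then show ?thesis by (simp add: e_def sum_distrib_left)
    qed
    then show ?thesis by (rule archimedean_if_conditionally_complete)
  qed
  then show ?thesis
    using dir dec nonneg x unfolding decreases_to_def by (auto intro: mult_right_mono)
qed

section \<open>Left multiplications\<close>

lemma zero_nbhd_mult_left:
  fixes c :: "'a :: {topological_ab_group_add, topological_semigroup_mult, ring}"
  assumes "zero_nbhd W"
  shows "zero_nbhd {v. c * v \<in> W}"
  using assms tendsto_mult[OF tendsto_const[of c "nhds 0"] filterlim_ident[of "nhds 0"]]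
  unfolding zero_nbhd_def filterlim_iff by (auto dest!: spec[of _ "\<lambda>x. x \<in> W"])

lemma zero_nbhd_mult_right:
  fixes c :: "'a :: {topological_ab_group_add, topological_semigroup_mult, ring}"
  assumes "zero_nbhd W"
  shows "zero_nbhd {v. v * c \<in> W}"
  using assms tendsto_mult[OF filterlim_ident[of "nhds 0"] tendsto_const[of c "nhds 0"]]
  unfolding zero_nbhd_def filterlim_iff by (auto dest!: spec[of _ "\<lambda>x. x \<in> W"])

lemma ring_bounded_singleton: "ring_bounded {c}"
  unfolding ring_bounded_def
proof (intro allI impI)
  fix W :: "'a set" assume "zero_nbhd W"
  then show "\<exists>V. zero_nbhd V \<and> (\<forall>v\<in>V. \<forall>b\<in>{c}. v * b \<in> W \<and> b * v \<in> W)"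
    using zero_nbhd_Int[OF zero_nbhd_mult_left[of W c] zero_nbhd_mult_right[of W c]] by blast
qed

lemma ring_bounded_mult_left:
  assumes "ring_bounded B"
  shows "ring_bounded ((\<lambda>x. c * x) ` B)"
  unfolding ring_bounded_def
proof (intro allI impI)
  fix W :: "'a set" assume W: "zero_nbhd W"
  obtain V1 where V1: "zero_nbhd V1" "\<forall>v\<in>V1. \<forall>b\<in>B. v * b \<in> W"
    using assms W unfolding ring_bounded_def by blast
  obtain V2 where V2: "zero_nbhd V2" "\<forall>v\<in>V2. \<forall>b\<in>B. c * (b * v) \<in> W"
    using assms zero_nbhd_mult_left[OF W, of c] unfolding ring_bounded_def by blast
  have "zero_nbhd ({v. v * c \<in> V1} \<inter> V2)"
    by (intro zero_nbhd_Int zero_nbhd_mult_right V1 V2)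
  moreover have "\<forall>v\<in>{v. v * c \<in> V1} \<inter> V2. \<forall>b\<in>(\<lambda>x. c * x) ` B. v * b \<in> W \<and> b * v \<in> W"
    using V1(2) V2(2) by (auto simp: mult.assoc[symmetric])
  ultimately show "\<exists>V. zero_nbhd V \<and> (\<forall>v\<in>V. \<forall>b\<in>(\<lambda>x. c * x) ` B. v * b \<in> W \<and> b * v \<in> W)"
    by blast
qed

text \<open>
  For \<open>c\<close> of arbitrary sign: splitting \<open>c = c\<^sup>+ + c\<^sup>-\<close>, the image of \<open>[r, s]\<close> lies between
  \<open>c\<^sup>+ * r + c\<^sup>- * s\<close> and \<open>c\<^sup>+ * s + c\<^sup>- * r\<close>.
\<close>

lemma order_bounded_map_mult_left: "order_bounded_map (\<lambda>x :: 'a :: lattice_ring. c * x)"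
  unfolding order_bounded_map_def
proof (intro allI impI)
  fix A :: "'a set" assume "order_bounded_set A"
  then obtain r s where A: "A \<subseteq> {r..s}" unfolding order_bounded_set_def by blast
  have split: "c * x = pprt c * x + nprt c * x" for x
    using prts[of c] by (metis distrib_right)
  have "c * x \<in> {pprt c * r + nprt c * s..pprt c * s + nprt c * r}" if "x \<in> A" for x
  proof -
    have "r \<le> x" "x \<le> s" using A that by auto
    then show ?thesis
      by (simp add: split add_mono mult_left_mono mult_left_mono_neg)
  qed
  then have "(\<lambda>x. c * x) ` A \<subseteq> {pprt c * r + nprt c * s..pprt c * s + nprt c * r}" by blast
  then show "order_bounded_set ((\<lambda>x. c * x) ` A)" unfolding order_bounded_set_def by blast
qed

lift_definition left_mult :: "'a :: locally_solid_lattice_ring \<Rightarrow> 'a hom_b_br"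
  is "\<lambda>c x. c * x"
  by (simp add: Modules.additive_def distrib_left order_bounded_map_mult_left br_bounded_def
      ring_bounded_mult_left)

lemma decreases_to_left_mult:
  fixes u :: "'i \<Rightarrow> 'a :: {locally_solid_f_ring, monoid_mult, conditionally_complete_lattice}"
  assumes u: "decreases_to A le u 0"
  shows "decreases_to A le (\<lambda>a. left_mult (u a)) 0"
proof -
  have "S \<le> 0" if S: "\<forall>a\<in>A. S \<le> left_mult (u a)" for S :: "'a hom_b_br"
  proof -
    have "hom_apply S x \<le> 0" if "0 \<le> x" for x
    proof -
      have "\<forall>a\<in>A. hom_apply S x \<le> u a * x"
        using S that by (simp add: less_eq_hom_b_br.rep_eq left_mult.rep_eq)
      then show ?thesis
        using decreases_to_mult_right[OF u that] unfolding decreases_to_def by blast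
    qed
    then show ?thesis by (simp add: less_eq_hom_b_br.rep_eq zero_hom_b_br.rep_eq)
  qed
  then show ?thesis
    using u unfolding decreases_to_def
    by (auto simp: less_eq_hom_b_br.rep_eq left_mult.rep_eq zero_hom_b_br.rep_eq
        intro: mult_right_mono)
qed

section \<open>The Lebesgue property\<close>

theorem proposition7:
  assumes "singletons_group_bounded
      TYPE('a :: {locally_solid_f_ring, monoid_mult, conditionally_complete_lattice})"
    and "fatou_property TYPE('a)"
    and "lebesgue_property TYPE('a hom_b_br)"
  shows "lebesgue_property TYPE('a)"
  unfolding lebesgue_property_def
proof (intro allI impI)
  fix A :: "'a set" and le and u :: "'a \<Rightarrow> 'a"
  assume "decreases_to A le u 0"
  then have "((\<lambda>a. left_mult (u a)) \<longlongrightarrow> 0) (tails A le)"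
    by (intro lebesgue_property_any_index assms(3) decreases_to_left_mult)
  then have conv: "\<forall>\<^sub>F a in tails A le. hom_apply (left_mult (u a) - 0) ` {1} \<subseteq> V"
    if "zero_nbhd V" for V
    using that ring_bounded_singleton unfolding tendsto_hom_b_br_iff by blast
  show "(u \<longlongrightarrow> 0) (tails A le)"
  proof (rule topological_tendstoI)
    fix V :: "'a set" assume "open V" "0 \<in> V"
    then have "zero_nbhd V" unfolding zero_nbhd_def by (rule eventually_nhds_in_open)
    from conv[OF this] show "\<forall>\<^sub>F a in tails A le. u a \<in> V"
      by (simp add: left_mult.rep_eq)
  qed
qed

end
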